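(* Let $1<p<q<\infty$ and $1<r<\infty$. Then $\ell^p_{q,r}(\mathbb Z)$ is reflexive.
   Context: For $j\in\mathbb N_0=\{0,1,2,\dots\}$ and $k\in\mathbb Z$ let $I(j,k)=[2^jk,2^j(k+1))\cap\mathbb Z$ (a discrete dyadic interval with $2^j$ elements). For a real sequence $x=(x(k))_{k\in\mathbb Z}$ put $$\|x\|_{\ell^p_{q,r}}=\Big(\sum_{j=0}^\infty\sum_{k\in\mathbb Z}(2^j)^{r(\frac1q-\frac1p)}\Big(\sum_{l\in I(j,k)}|x(l)|^p\Big)^{r/p}\Big)^{1/r},$$ and let $\ell^p_{q,r}(\mathbb Z)$ be the normed space of all $x\in\mathbb R^{\mathbb Z}$ with $\|x\|_{\ell^p_{q,r}}<\infty$. *)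

theory Defs
  imports "HOL-Analysis.Analysis" "HOL-Library.Function_Algebras"
begin

instantiation "fun" :: (type, real_vector) real_vector
begin

definition scaleR_fun_def: "c *\<^sub>R f = (\<lambda>x. c *\<^sub>R f x)"

instance
  by standard (simp_all add: scaleR_fun_def plus_fun_def fun_eq_iff scaleR_add_left scaleR_add_right)

end

text \<open>
  The sequence spaces below depend on real parameters, so normed spaces are given by a carrier
  \<open>V\<close> inside a real vector space together with a norm function \<open>N\<close>, of which only the values on
  \<open>V\<close> matter.
\<close>

definition normed_space_on :: "'a::real_vector set \<Rightarrow> ('a \<Rightarrow> real) \<Rightarrow> bool" where
  "normed_space_on V N \<longleftrightarrow>
     subspace V \<and>
     (\<forall>x\<in>V. 0 \<le> N x) \<and>
     (\<forall>x\<in>V. N x = 0 \<longleftrightarrow> x = 0) \<and>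
     (\<forall>c. \<forall>x\<in>V. N (c *\<^sub>R x) = \<bar>c\<bar> * N x) \<and>
     (\<forall>x\<in>V. \<forall>y\<in>V. N (x + y) \<le> N x + N y)"

text \<open>
  A functional on \<open>V\<close> is represented by the function on the whole type that vanishes outside
  \<open>V\<close>; thus distinct elements of the dual differ at a point of \<open>V\<close>, and the dual is again a
  carrier in a real vector space, so that the construction can be iterated.
\<close>

definition dual_space :: "'a::real_vector set \<Rightarrow> ('a \<Rightarrow> real) \<Rightarrow> ('a \<Rightarrow> real) set" where
  "dual_space V N =
     {\<phi>. (\<forall>x\<in>V. \<forall>y\<in>V. \<phi> (x + y) = \<phi> x + \<phi> y) \<and>
          (\<forall>c. \<forall>x\<in>V. \<phi> (c *\<^sub>R x) = c * \<phi> x) \<and>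
          (\<exists>C. \<forall>x\<in>V. \<bar>\<phi> x\<bar> \<le> C * N x) \<and>
          (\<forall>x. x \<notin> V \<longrightarrow> \<phi> x = 0)}"

definition dual_norm :: "'a::real_vector set \<Rightarrow> ('a \<Rightarrow> real) \<Rightarrow> ('a \<Rightarrow> real) \<Rightarrow> real" where
  "dual_norm V N \<phi> = (SUP x\<in>{x\<in>V. N x \<le> 1}. \<bar>\<phi> x\<bar>)"

definition bidual_embedding ::
  "'a::real_vector set \<Rightarrow> ('a \<Rightarrow> real) \<Rightarrow> 'a \<Rightarrow> ('a \<Rightarrow> real) \<Rightarrow> real" where
  "bidual_embedding V N x = (\<lambda>\<phi>. if \<phi> \<in> dual_space V N then \<phi> x else 0)"

definition reflexive_space :: "'a::real_vector set \<Rightarrow> ('a \<Rightarrow> real) \<Rightarrow> bool" where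
  "reflexive_space V N \<longleftrightarrow>
     normed_space_on V N \<and>
     bidual_embedding V N ` V = dual_space (dual_space V N) (dual_norm V N)"

definition dyadic_interval :: "nat \<Rightarrow> int \<Rightarrow> int set" where
  "dyadic_interval j k = {2 ^ j * k ..< 2 ^ j * (k + 1)}"

text \<open>Real powers of extended nonnegative reals, for exponents \<open>s > 0\<close> only.\<close>

definition ennreal_powr :: "ennreal \<Rightarrow> real \<Rightarrow> ennreal" where
  "ennreal_powr a s = (if a = \<infinity> then \<infinity> else ennreal (enn2real a powr s))"

definition lpqr_enorm :: "real \<Rightarrow> real \<Rightarrow> real \<Rightarrow> (int \<Rightarrow> real) \<Rightarrow> ennreal" where
  "lpqr_enorm p q r x =
     ennreal_powr
       (\<Sum>j. \<Sum>\<^sub>\<infinity>k\<in>UNIV.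
          ennreal ((2 ^ j) powr (r * (1 / q - 1 / p)) *
            (\<Sum>l\<in>dyadic_interval j k. \<bar>x l\<bar> powr p) powr (r / p)))
       (1 / r)"

definition lpqr_space :: "real \<Rightarrow> real \<Rightarrow> real \<Rightarrow> (int \<Rightarrow> real) set" where
  "lpqr_space p q r = {x. lpqr_enorm p q r x < \<infinity>}"

definition lpqr_norm :: "real \<Rightarrow> real \<Rightarrow> real \<Rightarrow> (int \<Rightarrow> real) \<Rightarrow> real" where
  "lpqr_norm p q r x = enn2real (lpqr_enorm p q r x)"

end

theory Submission
  imports Defs
begin

text \<open>
  Index the dyadic blocks by pairs \<open>a = (j, k)\<close> and let \<open>T a x\<close> be the summand of block \<open>a\<close>, so
  that the norm is \<open>N x = (\<Sum>a. T a x) powr (1 / r)\<close>. Reflexivity rests on three properties of this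
  norm on functions of \<open>l \<in> \<int>\<close>, where a function is cut off to a finite set of coordinates by
  replacing its other values by \<open>0\<close>.

  \<^item> The norm is order continuous (cutting \<open>x\<close> off to large finite sets approximates \<open>x\<close>), because a
    convergent sum has small tails and each block sees only finitely many coordinates.
  \<^item> It has the Fatou property (\<open>x\<close> lies in the space as soon as its finite cut-offs are bounded),
    because each finite partial sum of \<open>N x powr r\<close> already occurs for a finite cut-off of \<open>x\<close>.
  \<^item> If \<open>x\<close> and \<open>y\<close> have disjoint supports and norm at most \<open>1\<close>, then \<open>N (x + y) \<le> \<kappa>\<close> for a constant
    \<open>\<kappa> < 2\<close>. On one block the inner \<open>p\<close>-th powers add, and
    \<open>(u + v) powr (r / p) \<le> C * (u powr (r / p) + v powr (r / p))\<close> with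
    \<open>C = max 1 (2 powr (r / p - 1))\<close>; hence \<open>\<kappa> = (2 * C) powr (1 / r) = 2 powr max (1 / r) (1 / p)\<close>.
    It is below \<open>2\<close> because \<open>p > 1\<close> and \<open>r > 1\<close>.

  The third property makes every functional \<open>\<phi>\<close> in the dual small off a finite set
  (\<open>dual_small_off_finite\<close>): let \<open>\<delta>\<close> be the infimum of the norms of the restrictions of \<open>\<phi>\<close> to the
  vectors vanishing on a finite set. Off a set that almost realises the infimum there are two
  disjoint normalised vectors at which \<open>\<phi>\<close> is almost \<open>\<delta>\<close>; their sum gives \<open>2 * \<delta> \<le> \<delta> * \<kappa>\<close>,
  so \<open>\<delta> = 0\<close>.

  Now let \<open>\<psi>\<close> be in the bidual and put \<open>x i = \<psi> (coordinate i)\<close>. Then \<open>\<psi>\<close> agrees with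
  evaluation at \<open>x\<close> on functionals that depend on finitely many coordinates (\<open>bidual_finite\<close>).
  Testing with norming functionals of this kind bounds the finite cut-offs of \<open>x\<close>, so that \<open>x\<close> is
  in the space by the Fatou property; the smallness of functionals off finite sets together with
  order continuity extends \<open>\<psi> \<phi> = \<phi> x\<close> to all \<open>\<phi>\<close> (\<open>bidual_represented\<close>). The condition \<open>p < q\<close>
  makes the block weights summable over \<open>j\<close>, so that the unit vectors belong to the space.
\<close>

section \<open>Finite-dimensional Hahn--Banach\<close>

text \<open>
  Only norming functionals that depend on finitely many coordinates are needed. They arise by
  making a sublinear functional linear in one direction after another, while decreasing it.
\<close>

definition sublinear :: "('a::real_vector \<Rightarrow> real) \<Rightarrow> bool" where
  "sublinear p \<longleftrightarrow>
     (\<forall>x y. p (x + y) \<le> p x + p y) \<and> (\<forall>c\<ge>0. \<forall>x. p (c *\<^sub>R x) = c * p x)"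

lemma sublinear_add: "sublinear p \<Longrightarrow> p (x + y) \<le> p x + p y"
  and sublinear_scale: "sublinear p \<Longrightarrow> 0 \<le> c \<Longrightarrow> p (c *\<^sub>R x) = c * p x"
  by (simp_all add: sublinear_def)

lemma sublinear_zero: "sublinear p \<Longrightarrow> p 0 = 0"
  using sublinear_scale[of p 0 0] by simp

text \<open>
  The infimum of \<open>p (y + t *\<^sub>R x) - t * p x\<close> over \<open>t \<ge> 0\<close> is sublinear below \<open>p\<close>, and \<open>t = 1\<close> bounds
  its value at \<open>- x\<close>. As sublinear functionals satisfy \<open>- q x \<le> q (- x)\<close>, this forces \<open>q x = p x\<close>
  and linearity along \<open>x\<close>.
\<close>

lemma sublinear_straighten:
  fixes p :: "'a::real_vector \<Rightarrow> real"
  assumes p: "sublinear p"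
  obtains q where "sublinear q" "\<And>y. q y \<le> p y" "q (- x) \<le> - p x"
proof -
  define g where "g y t = p (y + t *\<^sub>R x) - t * p x" for y and t :: real
  define q where "q y = (INF t\<in>{0..}. g y t)" for y
  have lower: "- p (- y) \<le> g y t" if "0 \<le> t" for y t
    using sublinear_add[OF p, of "y + t *\<^sub>R x" "- y"] sublinear_scale[OF p that, of x]
    by (simp add: g_def)
  have q_le: "q y \<le> g y t" if "0 \<le> t" for y t
    unfolding q_def by (rule cINF_lower) (use that lower in \<open>auto intro!: bdd_belowI2\<close>)
  have q_ge: "u \<le> q y" if "\<And>t. 0 \<le> t \<Longrightarrow> u \<le> g y t" for u y
    unfolding q_def by (rule cINF_greatest) (use that in auto)
  have add: "q (y + z) \<le> q y + q z" for y z
  proof -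
    have "q (y + z) - g z s \<le> g y t" if "0 \<le> t" "0 \<le> s" for s t
    proof -
      have "q (y + z) \<le> g (y + z) (t + s)"
        using q_le that by simp
      also have "\<dots> \<le> g y t + g z s"
        using sublinear_add[OF p, of "y + t *\<^sub>R x" "z + s *\<^sub>R x"]
        by (simp add: g_def algebra_simps)
      finally show ?thesis by simp
    qed
    then have "q (y + z) - g z s \<le> q y" if "0 \<le> s" for s
      using q_ge that by blast
    then have "q (y + z) - q y \<le> q z"
      by (intro q_ge) (simp add: algebra_simps)
    then show ?thesis by simp
  qed
  have scale_le: "q (c *\<^sub>R y) \<le> c * q y" if "0 < c" for c y
  proof -
    have "q (c *\<^sub>R y) / c \<le> g y t" if "0 \<le> t" for t
    proof -
      have "q (c *\<^sub>R y) \<le> g (c *\<^sub>R y) (c * t)"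
        using q_le that \<open>0 < c\<close> by simp
      also have "\<dots> = c * g y t"
        using sublinear_scale[OF p, of c "y + t *\<^sub>R x"] \<open>0 < c\<close>
        by (simp add: g_def algebra_simps)
      finally show ?thesis using \<open>0 < c\<close> by (simp add: field_simps)
    qed
    then have "q (c *\<^sub>R y) / c \<le> q y"
      using q_ge by blast
    then show ?thesis using that by (simp add: field_simps)
  qed
  have "q (c *\<^sub>R y) = c * q y" if "0 \<le> c" for c y
  proof (cases "c = 0")
    case True
    have "g 0 t = 0" if "0 \<le> t" for t
      using sublinear_scale[OF p that, of x] by (simp add: g_def)
    then have "q 0 = 0"
      using q_le[of 0 0] q_ge[of 0 0] by simp
    then show ?thesis using True by simp
  next
    case False
    then have "0 < c" using that by simp
    have "q y \<le> q (c *\<^sub>R y) / c"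
      using scale_le[of "inverse c" "c *\<^sub>R y"] \<open>0 < c\<close> by (simp add: field_simps)
    then show ?thesis
      using scale_le[OF \<open>0 < c\<close>, of y] \<open>0 < c\<close> by (simp add: field_simps)
  qed
  then have "sublinear q" using add by (simp add: sublinear_def)
  moreover have "q y \<le> p y" for y
    using q_le[of 0 y] by (simp add: g_def)
  moreover have "q (- x) \<le> - p x"
    using q_le[of 1 "- x"] sublinear_zero[OF p] by (simp add: g_def)
  ultimately show thesis by (rule that)
qed

text \<open>
  A direction in which a sublinear functional is linear stays one when the functional is decreased
  further: \<open>q' (- b) \<le> q (- b) \<le> - q b \<le> - q' b\<close>. Hence directions can be treated one by one.
\<close>

lemma sublinear_straighten_finite:
  fixes p :: "'a::real_vector \<Rightarrow> real"
  assumes "finite B" "sublinear p"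
  shows "\<exists>q. sublinear q \<and> (\<forall>y. q y \<le> p y) \<and> (\<forall>b\<in>B. q (- b) \<le> - q b)"
  using assms(1)
proof induction
  case empty
  then show ?case using assms(2) by auto
next
  case (insert b B)
  then obtain q where q: "sublinear q" "\<And>y. q y \<le> p y" "\<And>b. b \<in> B \<Longrightarrow> q (- b) \<le> - q b"
    by auto
  obtain q' where q': "sublinear q'" "\<And>y. q' y \<le> q y" "q' (- b) \<le> - q b"
    using sublinear_straighten[OF q(1)] by blast
  have "q' (- a) \<le> - q' a" if "a \<in> insert b B" for a
    using that q(3)[of a] q'(2)[of a] q'(2)[of "- a"] q'(3) by auto
  then show ?case
    using q'(1,2) q(2) by (meson order_trans)
qed

text \<open>
  The directions \<open>b\<close> with \<open>q (- b) \<le> - q b\<close> form a subspace on which \<open>q\<close> is linear. Straightening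
  \<open>x\<close> before \<open>B\<close> keeps the value at \<open>x\<close> equal to \<open>p x\<close>, although \<open>x\<close> may lie outside the span.
\<close>

lemma sublinear_norming_finite_span:
  fixes p :: "'a::real_vector \<Rightarrow> real"
  assumes "finite B" "sublinear p"
  obtains q where "\<And>y. q y \<le> p y" "q x = p x"
    "\<And>y z. y \<in> span B \<Longrightarrow> q (y + z) = q y + q z"
    "\<And>y c. y \<in> span B \<Longrightarrow> q (c *\<^sub>R y) = c * q y"
proof -
  obtain q0 where q0: "sublinear q0" "\<And>y. q0 y \<le> p y" "q0 (- x) \<le> - p x"
    using sublinear_straighten[OF assms(2)] by blast
  obtain q where q: "sublinear q" "\<And>y. q y \<le> q0 y" "\<And>b. b \<in> B \<Longrightarrow> q (- b) \<le> - q b"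
    using sublinear_straighten_finite[OF assms(1) q0(1)] by auto
  have pos: "0 \<le> q b + q (- b)" for b
    using sublinear_add[OF q(1), of b "- b"] sublinear_zero[OF q(1)] by simp
  define S where "S = {b. q (- b) \<le> - q b}"
  have "subspace S"
  proof (rule subspaceI)
    show "0 \<in> S" by (simp add: S_def sublinear_zero[OF q(1)])
  next
    fix a b assume "a \<in> S" "b \<in> S"
    then show "a + b \<in> S"
      using sublinear_add[OF q(1), of a b] sublinear_add[OF q(1), of "- a" "- b"]
      by (simp add: S_def)
  next
    fix c :: real and b assume b: "b \<in> S"
    show "c *\<^sub>R b \<in> S"
    proof (cases "0 \<le> c")
      case True
      then show ?thesis
        using b sublinear_scale[OF q(1) True, of b] sublinear_scale[OF q(1) True, of "- b"]
          mult_left_mono[of "q (- b)" "- q b" c]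
        by (simp add: S_def)
    next
      case False
      then have "0 \<le> - c" by simp
      then show ?thesis
        using b sublinear_scale[OF q(1), of "- c" b] sublinear_scale[OF q(1), of "- c" "- b"]
          mult_left_mono[of "q (- b)" "- q b" "- c"]
        by (simp add: S_def)
    qed
  qed
  then have span: "span B \<subseteq> S"
    using q(3) by (intro span_minimal) (auto simp: S_def)
  have neg: "q (- y) = - q y" if "y \<in> span B" for y
    using pos[of y] span that by (force simp: S_def)
  show thesis
  proof (rule that[of q])
    show "q y \<le> p y" for y
      using q(2) q0(2) by (meson order_trans)
    show "q x = p x"
      using pos[of x] q(2)[of x] q(2)[of "- x"] q0(2)[of x] q0(3) by simp
    show "q (y + z) = q y + q z" if "y \<in> span B" for y z
      using sublinear_add[OF q(1), of y z] sublinear_add[OF q(1), of "- y" "y + z"] neg[OF that]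
      by simp
    show "q (c *\<^sub>R y) = c * q y" if "y \<in> span B" for y c
    proof (cases "0 \<le> c")
      case True
      then show ?thesis using sublinear_scale[OF q(1)] by simp
    next
      case False
      then have "q (c *\<^sub>R y) = - q ((- c) *\<^sub>R y)"
        using neg[of "(- c) *\<^sub>R y"] that by (simp add: span_neg span_scale)
      then show ?thesis
        using sublinear_scale[OF q(1), of "- c" y] False by simp
    qed
  qed
qed

section \<open>A reflexivity criterion for spaces of functions\<close>

definition cut :: "'i set \<Rightarrow> ('i \<Rightarrow> real) \<Rightarrow> 'i \<Rightarrow> real" where
  "cut A x = (\<lambda>i. if i \<in> A then x i else 0)"

definition unit_fun :: "'i \<Rightarrow> 'i \<Rightarrow> real" where
  "unit_fun i = (\<lambda>j. if j = i then 1 else 0)"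

lemma cut_add: "cut A (x + y) = cut A x + cut A y"
  and cut_scale: "cut A (c *\<^sub>R x) = c *\<^sub>R cut A x"
  and cut_cut: "cut A (cut B x) = cut (A \<inter> B) x"
  and cut_singleton: "cut {i} x = x i *\<^sub>R unit_fun i"
  by (auto simp: cut_def unit_fun_def fun_eq_iff scaleR_fun_def)

lemma cut_insert: "i \<notin> F \<Longrightarrow> cut (insert i F) x = x i *\<^sub>R unit_fun i + cut F x"
  by (auto simp: cut_def unit_fun_def fun_eq_iff scaleR_fun_def)

lemma cut_eq_sum: "finite F \<Longrightarrow> cut F x = (\<Sum>i\<in>F. x i *\<^sub>R unit_fun i)"
proof (induction rule: finite_induct)
  case empty
  show ?case by (simp add: cut_def zero_fun_def)
next
  case (insert i F)
  then show ?case by (simp add: cut_insert)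
qed

lemma dual_space_bounded:
  assumes "normed_space_on V N" "\<phi> \<in> dual_space V N"
  obtains C where "0 \<le> C" "\<And>x. x \<in> V \<Longrightarrow> \<bar>\<phi> x\<bar> \<le> C * N x"
proof -
  obtain C where C: "\<forall>x\<in>V. \<bar>\<phi> x\<bar> \<le> C * N x"
    using assms(2) by (auto simp: dual_space_def)
  have "\<bar>\<phi> x\<bar> \<le> \<bar>C\<bar> * N x" if "x \<in> V" for x
  proof -
    have "\<bar>\<phi> x\<bar> \<le> C * N x" using C that by blast
    also have "\<dots> \<le> \<bar>C\<bar> * N x"
      using assms(1) that by (intro mult_right_mono) (auto simp: normed_space_on_def)
    finally show ?thesis .
  qed
  then show thesis by (intro that[of "\<bar>C\<bar>"]) auto
qed

lemma dual_norm_le: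
  assumes "normed_space_on V N" "0 \<le> C" "\<And>x. x \<in> V \<Longrightarrow> \<bar>\<phi> x\<bar> \<le> C * N x"
  shows "dual_norm V N \<phi> \<le> C"
  unfolding dual_norm_def
proof (rule cSUP_least)
  have "0 \<in> V" "N 0 = 0"
    using assms(1) by (auto simp: normed_space_on_def subspace_0)
  then show "{x \<in> V. N x \<le> 1} \<noteq> {}" by force
  fix x assume "x \<in> {x \<in> V. N x \<le> 1}"
  then show "\<bar>\<phi> x\<bar> \<le> C"
    using assms(3)[of x] mult_left_mono[of "N x" 1 C] assms(2) by auto
qed

lemma dual_norm_bound:
  assumes V: "normed_space_on V N" and \<phi>: "\<phi> \<in> dual_space V N" and x: "x \<in> V"
  shows "\<bar>\<phi> x\<bar> \<le> dual_norm V N \<phi> * N x"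
proof (cases "x = 0")
  case True
  have "\<phi> (0 *\<^sub>R x) = 0 * \<phi> x" using \<phi> x unfolding dual_space_def by blast
  moreover have "N x = 0" using True V x by (simp add: normed_space_on_def)
  ultimately show ?thesis using True by simp
next
  case False
  then have pos: "0 < N x"
    using V x by (auto simp: normed_space_on_def less_le)
  obtain C where C: "0 \<le> C" "\<And>x. x \<in> V \<Longrightarrow> \<bar>\<phi> x\<bar> \<le> C * N x"
    using dual_space_bounded[OF V \<phi>] by blast
  let ?y = "inverse (N x) *\<^sub>R x"
  have y: "?y \<in> V" "N ?y = 1" "\<phi> ?y = inverse (N x) * \<phi> x"
    using V x pos \<phi> by (auto simp: normed_space_on_def subspace_scale dual_space_def)
  have "\<bar>\<phi> ?y\<bar> \<le> dual_norm V N \<phi>"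
    unfolding dual_norm_def
  proof (rule cSUP_upper)
    show "?y \<in> {x \<in> V. N x \<le> 1}" using y by simp
    show "bdd_above ((\<lambda>x. \<bar>\<phi> x\<bar>) ` {x \<in> V. N x \<le> 1})"
    proof (rule bdd_aboveI2)
      fix x assume "x \<in> {x \<in> V. N x \<le> 1}"
      then show "\<bar>\<phi> x\<bar> \<le> C"
        using C(2)[of x] mult_left_mono[of "N x" 1 C] C(1) by auto
    qed
  qed
  then show ?thesis using pos unfolding y(3) by (simp add: abs_mult field_simps)
qed

lemma dual_norm_nonneg:
  assumes V: "normed_space_on V N" and \<phi>: "\<phi> \<in> dual_space V N"
  shows "0 \<le> dual_norm V N \<phi>"
proof (cases "V = {0}")
  case True
  then have "{x \<in> V. N x \<le> 1} = {0}" using V by (auto simp: normed_space_on_def)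
  then show ?thesis by (simp add: dual_norm_def)
next
  case False
  then obtain x where x: "x \<in> V" "x \<noteq> 0"
    using V by (auto simp: normed_space_on_def subspace_def)
  then have "0 < N x" using V by (auto simp: normed_space_on_def less_le)
  moreover have "0 \<le> dual_norm V N \<phi> * N x"
    using dual_norm_bound[OF V \<phi> x(1)] by linarith
  ultimately show ?thesis by (simp add: zero_le_mult_iff)
qed

lemma subspace_dual_space:
  assumes V: "normed_space_on V N"
  shows "subspace (dual_space V N)"
proof (rule subspaceI)
  show "0 \<in> dual_space V N"
    by (auto simp: dual_space_def intro!: exI[of _ 0])
next
  fix \<phi> \<psi> assume \<phi>: "\<phi> \<in> dual_space V N" and \<psi>: "\<psi> \<in> dual_space V N"
  obtain C where C: "\<And>x. x \<in> V \<Longrightarrow> \<bar>\<phi> x\<bar> \<le> C * N x"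
    using dual_space_bounded[OF V \<phi>] by blast
  obtain D where D: "\<And>x. x \<in> V \<Longrightarrow> \<bar>\<psi> x\<bar> \<le> D * N x"
    using dual_space_bounded[OF V \<psi>] by blast
  have "\<forall>x\<in>V. \<bar>(\<phi> + \<psi>) x\<bar> \<le> (C + D) * N x"
    using C D by (fastforce simp: algebra_simps)
  then show "\<phi> + \<psi> \<in> dual_space V N"
    using \<phi> \<psi> by (auto simp: dual_space_def algebra_simps intro!: exI[of _ "C + D"])
next
  fix c :: real and \<phi> assume \<phi>: "\<phi> \<in> dual_space V N"
  obtain C where C: "\<And>x. x \<in> V \<Longrightarrow> \<bar>\<phi> x\<bar> \<le> C * N x"
    using dual_space_bounded[OF V \<phi>] by blast
  have "\<forall>x\<in>V. \<bar>c * \<phi> x\<bar> \<le> (\<bar>c\<bar> * C) * N x"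
    using mult_left_mono[OF C, of _ "\<bar>c\<bar>"] by (simp add: abs_mult mult.assoc)
  then have "\<exists>C. \<forall>x\<in>V. \<bar>c * \<phi> x\<bar> \<le> C * N x" by blast
  then show "c *\<^sub>R \<phi> \<in> dual_space V N"
    using \<phi> by (simp add: dual_space_def scaleR_fun_def algebra_simps)
qed

lemma bidual_embedding_mem:
  assumes V: "normed_space_on V N" and x: "x \<in> V"
  shows "bidual_embedding V N x \<in> dual_space (dual_space V N) (dual_norm V N)"
proof -
  have "\<phi> + \<psi> \<in> dual_space V N" "c *\<^sub>R \<phi> \<in> dual_space V N"
    if "\<phi> \<in> dual_space V N" "\<psi> \<in> dual_space V N" for \<phi> \<psi> c
    using that subspace_dual_space[OF V] by (auto simp: subspace_def)
  moreover have "\<forall>\<phi>\<in>dual_space V N. \<bar>\<phi> x\<bar> \<le> N x * dual_norm V N \<phi>"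
    using dual_norm_bound[OF V _ x] by (simp add: mult.commute)
  ultimately show ?thesis
    by (auto simp: dual_space_def[of "dual_space V N"] bidual_embedding_def scaleR_fun_def)
qed

text \<open>
  The last two assumptions say that two disjoint vectors of the unit ball never span a copy of the
  two-dimensional \<open>l\<^sup>1\<close> almost isometrically; they exclude \<open>l\<^sup>1\<close>, which satisfies all the others.
\<close>

locale solid_function_space =
  fixes V :: "('i \<Rightarrow> real) set" and N :: "('i \<Rightarrow> real) \<Rightarrow> real" and \<kappa> :: real
  assumes normed: "normed_space_on V N"
    and cut_mem: "x \<in> V \<Longrightarrow> cut A x \<in> V"
    and norm_cut_le: "x \<in> V \<Longrightarrow> N (cut A x) \<le> N x"
    and unit_mem: "unit_fun i \<in> V"
    and order_continuous: "x \<in> V \<Longrightarrow> 0 < e \<Longrightarrow> \<exists>F. finite F \<and> N (cut (- F) x) \<le> e"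
    and Fatou: "(\<And>F. finite F \<Longrightarrow> N (cut F x) \<le> C) \<Longrightarrow> x \<in> V"
    and disjoint_norm_le: "x \<in> V \<Longrightarrow> y \<in> V \<Longrightarrow> (\<And>i. x i = 0 \<or> y i = 0) \<Longrightarrow>
          N x \<le> 1 \<Longrightarrow> N y \<le> 1 \<Longrightarrow> N (x + y) \<le> \<kappa>"
    and less_two: "\<kappa> < 2"
begin

abbreviation "V' \<equiv> dual_space V N"
abbreviation "N' \<equiv> dual_norm V N"

lemma V_subspace: "subspace V"
  and N_nonneg: "x \<in> V \<Longrightarrow> 0 \<le> N x"
  and N_eq_0: "x \<in> V \<Longrightarrow> N x = 0 \<longleftrightarrow> x = 0"
  and N_scale: "x \<in> V \<Longrightarrow> N (c *\<^sub>R x) = \<bar>c\<bar> * N x"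
  and N_add: "x \<in> V \<Longrightarrow> y \<in> V \<Longrightarrow> N (x + y) \<le> N x + N y"
  using normed by (auto simp: normed_space_on_def)

lemmas V_closed = subspace_0[OF V_subspace] subspace_add[OF V_subspace]
  subspace_scale[OF V_subspace]

lemma dual_add: "\<phi> \<in> V' \<Longrightarrow> x \<in> V \<Longrightarrow> y \<in> V \<Longrightarrow> \<phi> (x + y) = \<phi> x + \<phi> y"
  and dual_scale: "\<phi> \<in> V' \<Longrightarrow> x \<in> V \<Longrightarrow> \<phi> (c *\<^sub>R x) = c * \<phi> x"
  and dual_outside: "\<phi> \<in> V' \<Longrightarrow> x \<notin> V \<Longrightarrow> \<phi> x = 0"
  by (auto simp: dual_space_def)

lemma dualI:
  assumes "\<And>x y. x \<in> V \<Longrightarrow> y \<in> V \<Longrightarrow> \<phi> (x + y) = \<phi> x + \<phi> y"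
    and "\<And>c x. x \<in> V \<Longrightarrow> \<phi> (c *\<^sub>R x) = c * \<phi> x"
    and "\<And>x. x \<in> V \<Longrightarrow> \<bar>\<phi> x\<bar> \<le> C * N x"
    and "\<And>x. x \<notin> V \<Longrightarrow> \<phi> x = 0"
  shows "\<phi> \<in> V'"
  unfolding dual_space_def using assms by blast

lemma cut_finite_mem: "finite F \<Longrightarrow> cut F x \<in> V"
  unfolding cut_eq_sum by (intro subspace_sum V_subspace V_closed unit_mem)

lemma cut_decomp: "x = cut A x + cut (- A) x"
  by (auto simp: cut_def fun_eq_iff)

lemma dual_split:
  assumes "\<phi> \<in> V'" "y \<in> V"
  shows "\<phi> y = \<phi> (cut A y) + \<phi> (cut (- A) y)"
proof -
  have "\<phi> y = \<phi> (cut A y + cut (- A) y)"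
    using cut_decomp[of y A] by (rule arg_cong)
  also have "\<dots> = \<phi> (cut A y) + \<phi> (cut (- A) y)"
    using assms by (intro dual_add cut_mem)
  finally show ?thesis .
qed

text \<open>
  \<open>D\<close> collects the bounds for \<open>\<phi>\<close> off finite sets, and its infimum \<open>\<delta>\<close> is used in two
  ways: some \<open>d < \<delta> + \<eta>\<close> is a bound off some \<open>F\<close>, while no bound below \<open>\<delta>\<close> holds off any finite
  set. If \<open>\<delta> > 0\<close>, two disjoint normalised vectors off \<open>F\<close> at which \<open>\<phi>\<close> is almost \<open>\<delta>\<close> contradict
  \<open>\<kappa> < 2\<close>. One of them is cut off to a finite set \<open>G\<close>, so that the other can be chosen off \<open>G\<close>.
\<close>

lemma dual_small_off_finite:
  assumes \<phi>: "\<phi> \<in> V'" and "0 < e"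
  shows "\<exists>F. finite F \<and> (\<forall>y\<in>V. (\<forall>i\<in>F. y i = 0) \<longrightarrow> \<bar>\<phi> y\<bar> \<le> e * N y)"
proof -
  obtain C where C: "0 \<le> C" "\<And>x. x \<in> V \<Longrightarrow> \<bar>\<phi> x\<bar> \<le> C * N x"
    using dual_space_bounded[OF normed \<phi>] by blast
  define D where
    "D = {d. 0 \<le> d \<and> (\<exists>F. finite F \<and> (\<forall>y\<in>V. (\<forall>i\<in>F. y i = 0) \<longrightarrow> \<bar>\<phi> y\<bar> \<le> d * N y))}"
  have "C \<in> D" unfolding D_def using C by (intro CollectI conjI exI[of _ "{}"]) auto
  have bdd: "bdd_below D" by (rule bdd_belowI[of _ 0]) (simp add: D_def)
  define \<delta> where "\<delta> = Inf D"
  have "0 \<le> \<delta>"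
    unfolding \<delta>_def
  proof (rule cInf_greatest)
    show "D \<noteq> {}" using \<open>C \<in> D\<close> by blast
  qed (simp add: D_def)
  have \<kappa>: "0 \<le> \<kappa>"
    using disjoint_norm_le[of 0 0] N_eq_0[of 0] V_closed(1) by simp
  have "\<delta> = 0"
  proof (rule ccontr)
    assume "\<delta> \<noteq> 0"
    then have \<delta>: "0 < \<delta>" using \<open>0 \<le> \<delta>\<close> by simp
    \<comment> \<open>the estimates below give \<open>\<delta> * (2 - \<kappa>) < 5 * \<eta>\<close>, so any divisor of at least 5 would do\<close>
    define \<eta> where "\<eta> = \<delta> * (2 - \<kappa>) / 8"
    have \<eta>: "0 < \<eta>" "\<eta> < \<delta>"
      using \<delta> less_two \<kappa> by (auto simp: \<eta>_def)
    have witness: "\<exists>y\<in>V. N y = 1 \<and> (\<forall>i\<in>F. y i = 0) \<and> \<delta> - \<eta> < \<phi> y" if "finite F" for F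
    proof -
      have "\<delta> - \<eta> \<notin> D"
        using cInf_lower[OF _ bdd, of "\<delta> - \<eta>"] \<eta>(1) unfolding \<delta>_def by linarith
      moreover have "0 \<le> \<delta> - \<eta>" using \<eta>(2) by simp
      ultimately obtain y where y: "y \<in> V" "\<forall>i\<in>F. y i = 0" "(\<delta> - \<eta>) * N y < \<bar>\<phi> y\<bar>"
        using \<open>finite F\<close> unfolding D_def not_le[symmetric] by blast
      have "y \<noteq> 0"
      proof
        assume "y = 0"
        moreover have "N 0 = 0" using N_eq_0 V_closed(1) by blast
        ultimately show False using y(3) C(2)[OF y(1)] by simp
      qed
      then have pos: "0 < N y" using N_nonneg[OF y(1)] N_eq_0[OF y(1)] by simp
      define z where "z = (sgn (\<phi> y) / N y) *\<^sub>R y"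
      have "\<phi> y \<noteq> 0" using y(3) mult_pos_pos[OF _ pos, of "\<delta> - \<eta>"] \<eta>(2) by auto
      then have "N z = 1"
        using N_scale[OF y(1)] pos by (simp add: z_def abs_mult abs_sgn_eq)
      moreover have "\<phi> z = \<bar>\<phi> y\<bar> / N y"
        using dual_scale[OF \<phi> y(1)] by (simp add: z_def abs_sgn mult.commute)
      then have "\<delta> - \<eta> < \<phi> z" using y(3) pos by (simp add: pos_less_divide_eq)
      moreover have "z \<in> V"
        unfolding z_def by (rule V_closed(3)[OF y(1)])
      moreover have "\<forall>i\<in>F. z i = 0"
        using y(2) by (simp add: z_def scaleR_fun_def)
      ultimately show ?thesis by blast
    qed
    obtain d where d: "d \<in> D" "d < \<delta> + \<eta>"
      using cInf_lessD[of D "\<delta> + \<eta>"] \<open>C \<in> D\<close> \<eta>(1) unfolding \<delta>_def by fastforce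
    then obtain F where F: "0 \<le> d" "finite F"
      "\<And>y. y \<in> V \<Longrightarrow> \<forall>i\<in>F. y i = 0 \<Longrightarrow> \<bar>\<phi> y\<bar> \<le> d * N y"
      unfolding D_def by blast
    obtain y where y: "y \<in> V" "N y = 1" "\<forall>i\<in>F. y i = 0" "\<delta> - \<eta> < \<phi> y"
      using witness[OF F(2)] by blast
    obtain G where G: "finite G" "N (cut (- G) y) \<le> \<eta> / (C + 1)"
      using order_continuous[OF y(1), of "\<eta> / (C + 1)"] \<eta>(1) C(1) by fastforce
    have "\<bar>\<phi> (cut (- G) y)\<bar> \<le> C * (\<eta> / (C + 1))"
      using C(2)[OF cut_mem[OF y(1)], of "- G"] mult_left_mono[OF G(2) C(1)] by linarith
    also have "\<dots> \<le> \<eta>"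
      using C(1) \<eta>(1) by (simp add: field_simps)
    finally have "\<delta> - 2 * \<eta> < \<phi> (cut G y)"
      using y(4) dual_split[OF \<phi> y(1), of G] by linarith
    moreover obtain z where z: "z \<in> V" "N z = 1" "\<forall>i\<in>F \<union> G. z i = 0" "\<delta> - \<eta> < \<phi> z"
      using witness[of "F \<union> G"] F(2) G(1) by blast
    ultimately have "2 * \<delta> - 3 * \<eta> < \<phi> (cut G y + z)"
      using dual_add[OF \<phi> cut_mem[OF y(1)] z(1), of G] by linarith
    also have "\<dots> \<le> d * N (cut G y + z)"
    proof -
      have "\<forall>i\<in>F. (cut G y + z) i = 0" using y(3) z(3) by (simp add: cut_def)
      then show ?thesis
        using F(3)[of "cut G y + z"] V_closed(2)[OF cut_mem[OF y(1)] z(1)] by (simp add: abs_le_iff)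
    qed
    also have "\<dots> \<le> d * \<kappa>"
    proof (intro mult_left_mono disjoint_norm_le F(1))
      show "cut G y i = 0 \<or> z i = 0" for i using z(3) by (simp add: cut_def)
      show "N (cut G y) \<le> 1" using norm_cut_le[OF y(1), of G] y(2) by simp
    qed (use cut_mem[OF y(1)] z in simp_all)
    also have "\<dots> \<le> (\<delta> + \<eta>) * \<kappa>"
      using d(2) \<kappa> by (intro mult_right_mono) auto
    also have "\<dots> \<le> \<delta> * \<kappa> + 2 * \<eta>"
      using mult_left_mono[of \<kappa> 2 \<eta>] less_two \<eta>(1) by (simp add: algebra_simps)
    finally have "\<delta> * (2 - \<kappa>) < 5 * \<eta>" by (simp add: algebra_simps)
    moreover have "\<delta> * (2 - \<kappa>) = 8 * \<eta>" by (simp add: \<eta>_def)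
    ultimately show False using \<eta>(1) by simp
  qed
  then obtain d where d: "d \<in> D" "d < e"
    using cInf_lessD[of D e] \<open>C \<in> D\<close> \<open>0 < e\<close> unfolding \<delta>_def by fastforce
  then obtain F where F: "finite F" "\<And>y. y \<in> V \<Longrightarrow> \<forall>i\<in>F. y i = 0 \<Longrightarrow> \<bar>\<phi> y\<bar> \<le> d * N y"
    unfolding D_def by blast
  then have "\<bar>\<phi> y\<bar> \<le> e * N y" if "y \<in> V" "\<forall>i\<in>F. y i = 0" for y
    using F(2)[OF that] d(2) N_nonneg[OF that(1)] mult_right_mono[of d e "N y"] by linarith
  then show ?thesis using F(1) by blast
qed

text \<open>Elements of the dual vanish outside \<open>V\<close>, whence the default value \<open>0\<close>.\<close>

definition cut_functional :: "'i set \<Rightarrow> (('i \<Rightarrow> real) \<Rightarrow> real) \<Rightarrow> ('i \<Rightarrow> real) \<Rightarrow> real" where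
  "cut_functional A \<phi> = (\<lambda>x. if x \<in> V then \<phi> (cut A x) else 0)"

definition coordinate :: "'i \<Rightarrow> ('i \<Rightarrow> real) \<Rightarrow> real" where
  "coordinate i = (\<lambda>x. if x \<in> V then x i else 0)"

lemma cut_functional_mem:
  assumes \<phi>: "\<phi> \<in> V'"
  shows "cut_functional A \<phi> \<in> V'"
proof -
  obtain C where C: "0 \<le> C" "\<And>x. x \<in> V \<Longrightarrow> \<bar>\<phi> x\<bar> \<le> C * N x"
    using dual_space_bounded[OF normed \<phi>] by blast
  show ?thesis
  proof (rule dualI)
    fix x assume x: "x \<in> V"
    have "\<bar>\<phi> (cut A x)\<bar> \<le> C * N x"
      using C(2)[OF cut_mem[OF x], of A] mult_left_mono[OF norm_cut_le[OF x, of A] C(1)] by linarith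
    then show "\<bar>cut_functional A \<phi> x\<bar> \<le> C * N x"
      using x by (simp add: cut_functional_def)
  qed (use \<phi> in \<open>auto simp: cut_functional_def cut_add cut_scale dual_add dual_scale V_closed cut_mem\<close>)
qed

lemma coordinate_mem: "coordinate i \<in> V'"
proof -
  have pos: "0 < N (unit_fun i)"
    using N_nonneg[OF unit_mem] N_eq_0[OF unit_mem]
    by (force simp: less_le unit_fun_def fun_eq_iff)
  show ?thesis
  proof (rule dualI)
    fix x assume x: "x \<in> V"
    have "\<bar>x i\<bar> * N (unit_fun i) = N (cut {i} x)"
      by (simp add: cut_singleton N_scale unit_mem)
    also have "\<dots> \<le> N x" by (rule norm_cut_le[OF x])
    finally show "\<bar>coordinate i x\<bar> \<le> inverse (N (unit_fun i)) * N x"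
      using pos x by (simp add: coordinate_def field_simps)
  next
    fix c x assume "x \<in> V"
    then have "c *\<^sub>R x \<in> V" by (rule V_closed)
    then show "coordinate i (c *\<^sub>R x) = c * coordinate i x"
      using \<open>x \<in> V\<close> by (simp add: coordinate_def scaleR_fun_def)
  qed (auto simp: coordinate_def V_closed)
qed

lemma cut_functional_insert:
  assumes \<phi>: "\<phi> \<in> V'" and "i \<notin> F"
  shows "cut_functional (insert i F) \<phi> = \<phi> (unit_fun i) *\<^sub>R coordinate i + cut_functional F \<phi>"
proof
  fix x
  show "cut_functional (insert i F) \<phi> x =
      (\<phi> (unit_fun i) *\<^sub>R coordinate i + cut_functional F \<phi>) x"
    using dual_add[OF \<phi> V_closed(3)[OF unit_mem] cut_mem, of x "x i" i F] dual_scale[OF \<phi> unit_mem]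
    by (auto simp: cut_functional_def coordinate_def cut_insert[OF \<open>i \<notin> F\<close>] scaleR_fun_def)
qed

text \<open>
  The norm of the cut-off to \<open>F\<close> is sublinear on all functions, and a sublinear minorant that is
  linear on the span of the unit vectors of \<open>F\<close>, composed with the cut-off, is a functional.
\<close>

lemma norming_functional:
  assumes "finite F"
  obtains \<phi> where "\<phi> \<in> V'" "N' \<phi> \<le> 1" "cut_functional F \<phi> = \<phi>" "\<phi> (cut F x) = N (cut F x)"
proof -
  define p where "p y = N (cut F y)" for y
  have mem: "cut F y \<in> V" for y by (rule cut_finite_mem[OF assms])
  have "sublinear p"
    by (auto simp: sublinear_def p_def cut_add cut_scale mem N_add N_scale)
  moreover have "finite (unit_fun ` F)" using assms by simp
  ultimately obtain q where q: "\<And>y. q y \<le> p y" "q (cut F x) = p (cut F x)"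
    "\<And>y z. y \<in> span (unit_fun ` F) \<Longrightarrow> q (y + z) = q y + q z"
    "\<And>y c. y \<in> span (unit_fun ` F) \<Longrightarrow> q (c *\<^sub>R y) = c * q y"
    using sublinear_norming_finite_span[of "unit_fun ` F" p "cut F x"] by metis
  have span: "cut F y \<in> span (unit_fun ` F)" for y
    unfolding cut_eq_sum[OF assms] by (intro span_sum span_scale span_base) auto
  define \<phi> where "\<phi> y = (if y \<in> V then q (cut F y) else 0)" for y
  have bound: "\<bar>\<phi> y\<bar> \<le> 1 * N y" if y: "y \<in> V" for y
  proof -
    have "- q (cut F y) = q ((-1) *\<^sub>R cut F y)"
      using q(4)[OF span, of "-1" y] by simp
    also have "\<dots> \<le> p ((-1) *\<^sub>R cut F y)" by (rule q(1))
    also have "\<dots> = p y" by (simp add: p_def cut_scale cut_cut N_scale mem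
          del: scaleR_minus_left scaleR_minus1_left)
    finally have "- q (cut F y) \<le> p y" .
    moreover have "q (cut F y) \<le> p y" using q(1)[of "cut F y"] by (simp add: p_def cut_cut)
    ultimately show ?thesis
      using norm_cut_le[OF y, of F] y by (simp add: \<phi>_def p_def)
  qed
  show thesis
  proof (rule that[of \<phi>])
    show "\<phi> \<in> V'"
    proof (rule dualI)
      show "\<bar>\<phi> y\<bar> \<le> 1 * N y" if "y \<in> V" for y by (rule bound[OF that])
    qed (auto simp: \<phi>_def cut_add cut_scale q(3,4) span V_closed)
    show "N' \<phi> \<le> 1"
      by (rule dual_norm_le[OF normed]) (use bound in auto)
    show "cut_functional F \<phi> = \<phi>"
      by (auto simp: cut_functional_def \<phi>_def cut_cut mem fun_eq_iff)
    show "\<phi> (cut F x) = N (cut F x)"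
      using q(2) by (simp add: \<phi>_def mem cut_cut p_def)
  qed
qed

text \<open>
  A functional that depends on finitely many coordinates is a linear combination of coordinate
  functionals, at which \<open>\<psi>\<close> is known by definition of \<open>x\<close>.
\<close>

lemma bidual_finite:
  assumes \<psi>: "\<psi> \<in> dual_space V' N'" and \<phi>: "\<phi> \<in> V'" and "finite F"
  shows "\<psi> (cut_functional F \<phi>) = \<phi> (cut F (\<lambda>i. \<psi> (coordinate i)))"
  using \<open>finite F\<close>
proof induction
  case empty
  have *: "\<phi> 0 = 0" using dual_scale[OF \<phi> V_closed(1), of 0] by simp
  have "cut_functional {} \<phi> = 0 *\<^sub>R \<phi>"
    by (auto simp: cut_functional_def cut_def fun_eq_iff * zero_fun_def[symmetric])
  moreover have "\<psi> (0 *\<^sub>R \<phi>) = 0 * \<psi> \<phi>"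
    using \<psi> \<phi> unfolding dual_space_def[of V'] by blast
  ultimately show ?case by (simp add: cut_def * zero_fun_def[symmetric])
next
  case (insert i F)
  let ?x = "\<lambda>i. \<psi> (coordinate i)"
  have "\<psi> (cut_functional (insert i F) \<phi>) =
      \<phi> (unit_fun i) * \<psi> (coordinate i) + \<psi> (cut_functional F \<phi>)"
    using \<psi> subspace_scale[OF subspace_dual_space[OF normed] coordinate_mem]
      cut_functional_mem[OF \<phi>] coordinate_mem
    by (simp add: cut_functional_insert[OF \<phi> insert.hyps(2)] dual_space_def[of V'])
  also have "\<dots> = \<phi> (?x i *\<^sub>R unit_fun i) + \<phi> (cut F ?x)"
    using insert.IH dual_scale[OF \<phi> unit_mem] by simp
  also have "\<dots> = \<phi> (cut (insert i F) ?x)"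
    using dual_add[OF \<phi> V_closed(3)[OF unit_mem] cut_finite_mem[OF insert.hyps(1)]]
    by (simp add: cut_insert[OF insert.hyps(2)])
  finally show ?case .
qed

text \<open>
  Norming functionals bound the finite cut-offs of \<open>x\<close>, so that \<open>x \<in> V\<close> by the Fatou property. For
  the formula, split \<open>\<phi>\<close> and \<open>x\<close> along a large finite set: the finite parts agree, and the remaining
  part of \<open>\<phi>\<close> has small norm, as has that of \<open>x\<close>.
\<close>

lemma bidual_represented:
  assumes \<psi>: "\<psi> \<in> dual_space V' N'"
  defines "x \<equiv> \<lambda>i. \<psi> (coordinate i)"
  shows "x \<in> V" and "\<phi> \<in> V' \<Longrightarrow> \<psi> \<phi> = \<phi> x"
proof -
  obtain C0 where C0: "\<And>\<phi>. \<phi> \<in> V' \<Longrightarrow> \<bar>\<psi> \<phi>\<bar> \<le> C0 * N' \<phi>"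
    using \<psi> unfolding dual_space_def[of V'] by blast
  define C where "C = \<bar>C0\<bar>"
  have C: "0 \<le> C" "\<bar>\<psi> \<phi>\<bar> \<le> C * N' \<phi>" if "\<phi> \<in> V'" for \<phi>
  proof -
    show "0 \<le> C" by (simp add: C_def)
    have "C0 * N' \<phi> \<le> C * N' \<phi>"
      using dual_norm_nonneg[OF normed that] by (intro mult_right_mono) (auto simp: C_def)
    then show "\<bar>\<psi> \<phi>\<bar> \<le> C * N' \<phi>" using C0[OF that] by linarith
  qed
  have "N (cut F x) \<le> C" if F: "finite F" for F
  proof -
    obtain \<phi> where \<phi>: "\<phi> \<in> V'" "N' \<phi> \<le> 1" "cut_functional F \<phi> = \<phi>" "\<phi> (cut F x) = N (cut F x)"
      using norming_functional[OF F] by blast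
    then have "N (cut F x) = \<psi> \<phi>"
      using bidual_finite[OF \<psi> \<phi>(1) F] by (simp add: x_def)
    also have "\<dots> \<le> C * 1"
      using C[OF \<phi>(1)] mult_left_mono[OF \<phi>(2), of C] by linarith
    finally show ?thesis by simp
  qed
  then show x: "x \<in> V" by (rule Fatou)
  assume \<phi>: "\<phi> \<in> V'"
  obtain K where K: "0 \<le> K" "\<And>y. y \<in> V \<Longrightarrow> \<bar>\<phi> y\<bar> \<le> K * N y"
    using dual_space_bounded[OF normed \<phi>] by blast
  have "\<bar>\<psi> \<phi> - \<phi> x\<bar> \<le> e * (C + K)" if "0 < e" for e
  proof -
    obtain F1 where F1: "finite F1" "\<And>y. y \<in> V \<Longrightarrow> \<forall>i\<in>F1. y i = 0 \<Longrightarrow> \<bar>\<phi> y\<bar> \<le> e * N y"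
      using dual_small_off_finite[OF \<phi> \<open>0 < e\<close>] by blast
    obtain F2 where F2: "finite F2" "N (cut (- F2) x) \<le> e"
      using order_continuous[OF x \<open>0 < e\<close>] by blast
    let ?F = "F1 \<union> F2"
    have F: "finite ?F" using F1 F2 by simp
    have "N' (cut_functional (- ?F) \<phi>) \<le> e"
    proof (rule dual_norm_le[OF normed])
      fix y assume y: "y \<in> V"
      have "\<bar>\<phi> (cut (- ?F) y)\<bar> \<le> e * N (cut (- ?F) y)"
        using cut_mem[OF y] by (rule F1(2)) (simp add: cut_def)
      also have "\<dots> \<le> e * N y"
        using norm_cut_le[OF y] that by simp
      finally show "\<bar>cut_functional (- ?F) \<phi> y\<bar> \<le> e * N y"
        using y by (simp add: cut_functional_def)
    qed (use that in simp)
    then have "C * N' (cut_functional (- ?F) \<phi>) \<le> C * e"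
      using C(1)[OF \<phi>] by (intro mult_left_mono)
    then have 1: "\<bar>\<psi> (cut_functional (- ?F) \<phi>)\<bar> \<le> C * e"
      using C(2)[OF cut_functional_mem[OF \<phi>], of "- ?F"] by linarith
    have "\<phi> = cut_functional ?F \<phi> + cut_functional (- ?F) \<phi>"
    proof
      fix y
      show "\<phi> y = (cut_functional ?F \<phi> + cut_functional (- ?F) \<phi>) y"
        using dual_split[OF \<phi>, of y ?F] dual_outside[OF \<phi>, of y]
        by (cases "y \<in> V") (simp_all add: cut_functional_def)
    qed
    then have "\<psi> \<phi> = \<psi> (cut_functional ?F \<phi> + cut_functional (- ?F) \<phi>)"
      by (rule arg_cong)
    also have "\<dots> = \<psi> (cut_functional ?F \<phi>) + \<psi> (cut_functional (- ?F) \<phi>)"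
      using \<psi> cut_functional_mem[OF \<phi>] unfolding dual_space_def[of V'] by blast
    finally have "\<psi> \<phi> = \<psi> (cut_functional ?F \<phi>) + \<psi> (cut_functional (- ?F) \<phi>)" .
    moreover have "\<psi> (cut_functional ?F \<phi>) = \<phi> (cut ?F x)"
      using bidual_finite[OF \<psi> \<phi> F] by (simp add: x_def)
    moreover have "\<phi> x = \<phi> (cut ?F x) + \<phi> (cut (- ?F) x)"
      by (rule dual_split[OF \<phi> x])
    moreover have "\<bar>\<phi> (cut (- ?F) x)\<bar> \<le> K * e"
    proof -
      have "N (cut (- ?F) x) \<le> N (cut (- F2) x)"
        using norm_cut_le[OF cut_mem[OF x, of "- F2"], of "- F1"] by (simp add: cut_cut)
      then have "K * N (cut (- ?F) x) \<le> K * e"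
        using F2(2) K(1) by (intro mult_left_mono) auto
      then show ?thesis using K(2)[OF cut_mem[OF x], of "- ?F"] by linarith
    qed
    ultimately show ?thesis using 1 by (simp add: algebra_simps)
  qed
  note small = this
  have CK: "0 \<le> C + K" using C(1)[OF \<phi>] K by simp
  have "\<bar>\<psi> \<phi> - \<phi> x\<bar> \<le> 0"
  proof (rule field_le_epsilon)
    fix e :: real assume "0 < e"
    then have "\<bar>\<psi> \<phi> - \<phi> x\<bar> \<le> e / (C + K + 1) * (C + K)"
      using CK by (intro small) simp
    also have "\<dots> \<le> 0 + e" using CK \<open>0 < e\<close> by (simp add: field_simps)
    finally show "\<bar>\<psi> \<phi> - \<phi> x\<bar> \<le> 0 + e" .
  qed
  then show "\<psi> \<phi> = \<phi> x" by simp
qed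

lemma reflexive: "reflexive_space V N"
proof -
  have "\<psi> \<in> bidual_embedding V N ` V" if \<psi>: "\<psi> \<in> dual_space V' N'" for \<psi>
  proof
    show "\<psi> = bidual_embedding V N (\<lambda>i. \<psi> (coordinate i))"
      using bidual_represented(2)[OF \<psi>] \<psi>
      by (auto simp: bidual_embedding_def fun_eq_iff dual_space_def[of V'])
    show "(\<lambda>i. \<psi> (coordinate i)) \<in> V" by (rule bidual_represented(1)[OF \<psi>])
  qed
  then show ?thesis
    using normed bidual_embedding_mem[OF normed] by (auto simp: reflexive_space_def)
qed

end

section \<open>Norms given by a sum of local convex terms\<close>

text \<open>The endpoint \<open>0\<close> is included, in contrast to \<open>powr_convex\<close>.\<close>

lemma powr_convex_nonneg:
  fixes u v t p :: real
  assumes "1 \<le> p" "0 \<le> u" "0 \<le> v" "0 \<le> t" "t \<le> 1"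
  shows "((1 - t) * u + t * v) powr p \<le> (1 - t) * u powr p + t * v powr p"
proof -
  have scale: "(s * w) powr p \<le> s * w powr p" if "0 \<le> s" "s \<le> 1" "0 \<le> w" for s w :: real
  proof (cases "s = 0")
    case False
    then have "s powr p \<le> s" using that \<open>1 \<le> p\<close> by (intro powr_le_one_le) auto
    then show ?thesis using that by (simp add: powr_mult mult_right_mono)
  qed simp
  show ?thesis
  proof (cases "u = 0 \<or> v = 0")
    case True
    then show ?thesis using assms scale[of t v] scale[of "1 - t" u] by auto
  next
    case False
    then show ?thesis
      using convex_onD[OF powr_convex[OF \<open>1 \<le> p\<close>], of t u v] assms by simp
  qed
qed

text \<open>
  For \<open>s \<le> 1\<close> this is subadditivity, since \<open>w \<le> w powr s\<close> for the fractions \<open>w = u / (u + v)\<close> and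
  \<open>w = v / (u + v)\<close>; for \<open>s \<ge> 1\<close> it is convexity at the midpoint.
\<close>

lemma powr_add_le:
  fixes u v s :: real
  assumes "0 < s" "0 \<le> u" "0 \<le> v"
  shows "(u + v) powr s \<le> max 1 (2 powr (s - 1)) * (u powr s + v powr s)"
proof (cases "s \<le> 1")
  case True
  have "(u + v) powr s \<le> u powr s + v powr s"
  proof (cases "u + v = 0")
    case False
    then have pos: "0 < u + v" using assms by simp
    have "w / (u + v) \<le> (w / (u + v)) powr s" if "0 \<le> w" "w \<le> u + v" for w
      using powr_mono'[of s 1 "w / (u + v)"] True that pos by simp
    then have "u / (u + v) + v / (u + v) \<le> (u / (u + v)) powr s + (v / (u + v)) powr s"
      using assms by (intro add_mono) auto
    then have "1 \<le> (u powr s + v powr s) / (u + v) powr s"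
      using pos by (simp add: powr_divide add_divide_distrib[symmetric])
    then show ?thesis using pos by (simp add: field_simps)
  qed simp
  also have "\<dots> \<le> max 1 (2 powr (s - 1)) * (u powr s + v powr s)"
    using mult_right_mono[of 1 "max 1 (2 powr (s - 1))" "u powr s + v powr s"] by simp
  finally show ?thesis .
next
  case False
  have "(u + v) powr s = 2 powr s * ((1 - 1/2) * u + 1/2 * v) powr s"
    by (simp add: powr_mult[symmetric] algebra_simps)
  also have "\<dots> \<le> 2 powr s * ((1 - 1/2) * u powr s + 1/2 * v powr s)"
    using False assms by (intro mult_left_mono powr_convex_nonneg) auto
  also have "\<dots> = 2 powr (s - 1) * (u powr s + v powr s)"
    by (simp add: powr_diff algebra_simps)
  also have "\<dots> \<le> max 1 (2 powr (s - 1)) * (u powr s + v powr s)"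
    by (intro mult_right_mono) auto
  finally show ?thesis .
qed

text \<open>
  The unit ball \<open>{x. G x \<le> 1}\<close> is convex, and \<open>G x powr (1 / r)\<close> is its gauge. With \<open>a\<close> and \<open>b\<close>
  slightly above the gauges of \<open>x\<close> and \<open>y\<close>, the vector \<open>(x + y) / (a + b)\<close> is a convex combination
  of the elements \<open>x / a\<close> and \<open>y / b\<close> of the unit ball. The slack \<open>e\<close> keeps \<open>a\<close> and \<open>b\<close> positive.
  The lemma serves both for the inner sums and for the outer one.
\<close>

lemma triangle_of_convex_homogeneous:
  fixes G :: "'a::real_vector \<Rightarrow> real"
  assumes V: "subspace V" and r: "0 < r"
    and nonneg: "\<And>x. x \<in> V \<Longrightarrow> 0 \<le> G x"
    and scale: "\<And>c x. x \<in> V \<Longrightarrow> G (c *\<^sub>R x) = \<bar>c\<bar> powr r * G x"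
    and convex: "\<And>t x y. x \<in> V \<Longrightarrow> y \<in> V \<Longrightarrow> 0 \<le> t \<Longrightarrow> t \<le> 1 \<Longrightarrow>
          G ((1 - t) *\<^sub>R x + t *\<^sub>R y) \<le> (1 - t) * G x + t * G y"
    and x: "x \<in> V" and y: "y \<in> V"
  shows "G (x + y) powr (1 / r) \<le> G x powr (1 / r) + G y powr (1 / r)"
proof (rule field_le_epsilon)
  fix e :: real assume e: "0 < e"
  define a where "a = G x powr (1 / r) + e / 2"
  define b where "b = G y powr (1 / r) + e / 2"
  have pos: "0 < a" "0 < b"
    using e by (auto simp: a_def b_def intro!: add_nonneg_pos)
  have unit_ball: "G (inverse c *\<^sub>R z) \<le> 1" if "z \<in> V" "0 < c" "G z powr (1 / r) \<le> c" for c z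
  proof -
    have "G z = (G z powr (1 / r)) powr r"
      using nonneg[OF that(1)] r by (simp add: powr_powr)
    also have "\<dots> \<le> c powr r" using that r by (intro powr_mono2) auto
    finally show ?thesis
      using that by (simp add: scale powr_divide inverse_eq_divide field_simps)
  qed
  define t where "t = b / (a + b)"
  have t: "0 \<le> t" "t \<le> 1" using pos by (auto simp: t_def)
  have "inverse (a + b) *\<^sub>R (x + y) = (1 - t) *\<^sub>R (inverse a *\<^sub>R x) + t *\<^sub>R (inverse b *\<^sub>R y)"
  proof -
    have "(1 - t) * inverse a = inverse (a + b)" "t * inverse b = inverse (a + b)"
      using pos by (auto simp: t_def field_simps)
    then show ?thesis by (simp add: scaleR_add_right)
  qed
  then have "G (inverse (a + b) *\<^sub>R (x + y)) \<le>
      (1 - t) * G (inverse a *\<^sub>R x) + t * G (inverse b *\<^sub>R y)"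
    using convex[of "inverse a *\<^sub>R x" "inverse b *\<^sub>R y" t] t x y V by (simp add: subspace_scale)
  also have "\<dots> \<le> (1 - t) * 1 + t * 1"
    using t pos e x y by (intro add_mono mult_left_mono unit_ball) (auto simp: a_def b_def)
  finally have *: "G (inverse (a + b) *\<^sub>R (x + y)) \<le> 1" by simp
  have "G (x + y) = (a + b) powr r * G (inverse (a + b) *\<^sub>R (x + y))"
    using pos scale[OF subspace_add[OF V x y], of "inverse (a + b)"]
    by (simp add: inverse_powr)
  also have "\<dots> \<le> (a + b) powr r * 1"
    using * by (intro mult_left_mono) auto
  finally have "G (x + y) \<le> (a + b) powr r" by simp
  then have "G (x + y) powr (1 / r) \<le> ((a + b) powr r) powr (1 / r)"
    using r nonneg[OF subspace_add[OF V x y]] by (intro powr_mono2) auto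
  also have "\<dots> = a + b" using r pos by (simp add: powr_powr)
  finally show "G (x + y) powr (1 / r) \<le> G x powr (1 / r) + G y powr (1 / r) + e"
    by (simp add: a_def b_def)
qed

text \<open>
  The index \<open>a\<close> stands for a block with coordinates \<open>S a\<close>. Taking \<open>T a\<close> homogeneous of degree \<open>r\<close>
  instead of a seminorm makes \<open>N x powr r\<close> a plain sum, so that all estimates can be made termwise.
  The bound \<open>2 * C < 2 powr r\<close> turns the termwise estimate for disjoint functions into
  \<open>N (x + y) \<le> (2 * C) powr (1 / r) < 2\<close> on the unit ball.
\<close>

locale local_convex_sum =
  fixes T :: "'a \<Rightarrow> ('i \<Rightarrow> real) \<Rightarrow> real" and S :: "'a \<Rightarrow> 'i set" and r C :: real
  assumes r_pos: "0 < r"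
    and T_nonneg: "0 \<le> T a x"
    and finite_S: "finite (S a)"
    and T_local: "T a (cut (S a) x) = T a x"
    and T_mono: "(\<And>i. \<bar>x i\<bar> \<le> \<bar>y i\<bar>) \<Longrightarrow> T a x \<le> T a y"
    and T_scale: "T a (c *\<^sub>R x) = \<bar>c\<bar> powr r * T a x"
    and T_convex: "0 \<le> t \<Longrightarrow> t \<le> 1 \<Longrightarrow> T a ((1 - t) *\<^sub>R x + t *\<^sub>R y) \<le> (1 - t) * T a x + t * T a y"
    and T_disjoint: "(\<And>i. x i = 0 \<or> y i = 0) \<Longrightarrow> T a (x + y) \<le> C * (T a x + T a y)"
    and C_bounds: "0 \<le> C" "2 * C < 2 powr r"
    and T_unit: "(\<lambda>a. T a (unit_fun i)) summable_on UNIV"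
    and T_separates: "(\<And>a. T a x = 0) \<Longrightarrow> x = 0"
begin

definition V :: "('i \<Rightarrow> real) set" where
  "V = {x. (\<lambda>a. T a x) summable_on UNIV}"

definition G :: "('i \<Rightarrow> real) \<Rightarrow> real" where
  "G x = (\<Sum>\<^sub>\<infinity>a. T a x)"

definition N :: "('i \<Rightarrow> real) \<Rightarrow> real" where
  "N x = G x powr (1 / r)"

lemma G_nonneg: "0 \<le> G x"
  unfolding G_def by (intro infsum_nonneg T_nonneg)

lemma N_le_iff: "0 \<le> c \<Longrightarrow> N x \<le> c \<longleftrightarrow> G x \<le> c powr r"
proof
  assume "0 \<le> c" "N x \<le> c"
  then have "(G x powr (1 / r)) powr r \<le> c powr r"
    unfolding N_def using r_pos by (intro powr_mono2) auto
  then show "G x \<le> c powr r" using r_pos G_nonneg by (simp add: powr_powr)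
next
  assume "0 \<le> c" "G x \<le> c powr r"
  then have "G x powr (1 / r) \<le> (c powr r) powr (1 / r)"
    using r_pos G_nonneg by (intro powr_mono2) auto
  then show "N x \<le> c" using r_pos \<open>0 \<le> c\<close> by (simp add: N_def powr_powr)
qed

lemma T_zero: "T a 0 = 0"
  using T_scale[of a 0 0] by simp

lemma T_eq_0_off: "cut (S a) x = 0 \<Longrightarrow> T a x = 0"
  using T_local[of a x] T_zero by simp

lemma V_dominated: "(\<lambda>a. f a) summable_on UNIV \<Longrightarrow> (\<And>a. T a x \<le> f a) \<Longrightarrow> x \<in> V"
  unfolding V_def using T_nonneg by (auto intro: summable_on_comparison_test)

lemma V_summable: "x \<in> V \<Longrightarrow> (\<lambda>a. T a x) summable_on UNIV"
  by (simp add: V_def)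

lemma T_add_le: "T a (x + y) \<le> 2 powr r * (T a x + T a y)"
proof -
  have "T a (x + y) = 2 powr r * T a ((1 - 1/2) *\<^sub>R x + (1/2) *\<^sub>R y)"
    using T_scale[of a 2 "(1 - 1/2) *\<^sub>R x + (1/2) *\<^sub>R y"] by (simp add: scaleR_add_right)
  also have "\<dots> \<le> 2 powr r * ((1 - 1/2) * T a x + 1/2 * T a y)"
    by (intro mult_left_mono T_convex) auto
  also have "\<dots> \<le> 2 powr r * (T a x + T a y)"
    using T_nonneg[of a x] T_nonneg[of a y] by (intro mult_left_mono) auto
  finally show ?thesis .
qed

lemma V_subspace: "subspace V"
proof (rule subspaceI)
  show "0 \<in> V" by (simp add: V_def T_zero)
  show "x + y \<in> V" if "x \<in> V" "y \<in> V" for x y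
  proof (rule V_dominated)
    show "(\<lambda>a. 2 powr r * (T a x + T a y)) summable_on UNIV"
      by (rule summable_on_cmult_right[OF summable_on_add[OF that[THEN V_summable]]])
    show "T a (x + y) \<le> 2 powr r * (T a x + T a y)" for a by (rule T_add_le)
  qed
  show "c *\<^sub>R x \<in> V" if "x \<in> V" for c x
    using that by (simp add: V_def T_scale summable_on_cmult_right)
qed

lemma G_scale: "G (c *\<^sub>R x) = \<bar>c\<bar> powr r * G x"
  by (simp add: G_def T_scale infsum_cmult_right')

lemma G_le:
  assumes "(\<lambda>a. f a) summable_on UNIV" "\<And>a. T a x \<le> f a"
  shows "G x \<le> (\<Sum>\<^sub>\<infinity>a. f a)"
  unfolding G_def using assms
  by (intro infsum_mono V_summable V_dominated[of f]) auto

lemma G_convex: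
  assumes "x \<in> V" "y \<in> V" "0 \<le> t" "t \<le> 1"
  shows "G ((1 - t) *\<^sub>R x + t *\<^sub>R y) \<le> (1 - t) * G x + t * G y"
proof -
  have "G ((1 - t) *\<^sub>R x + t *\<^sub>R y) \<le> (\<Sum>\<^sub>\<infinity>a. (1 - t) * T a x + t * T a y)"
    using assms by (intro G_le summable_on_add summable_on_cmult_right V_summable T_convex)
  also have "\<dots> = (1 - t) * G x + t * G y"
    using assms
    by (simp add: G_def infsum_add summable_on_cmult_right V_summable infsum_cmult_right')
  finally show ?thesis .
qed

lemma G_eq_0: "x \<in> V \<Longrightarrow> G x = 0 \<Longrightarrow> x = 0"
  using nonneg_infsum_le_0D[of "\<lambda>a. T a x" UNIV] T_nonneg
  by (intro T_separates) (auto simp: G_def V_summable)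

lemma V_normed: "normed_space_on V N"
  unfolding normed_space_on_def
proof (intro conjI ballI allI V_subspace)
  show "0 \<le> N x" for x by (simp add: N_def)
  show "N x = 0 \<longleftrightarrow> x = 0" if "x \<in> V" for x
    using G_eq_0[OF that] by (auto simp: N_def G_def T_zero)
  show "N (c *\<^sub>R x) = \<bar>c\<bar> * N x" for c x
    using r_pos by (simp add: N_def G_scale powr_mult powr_powr)
  show "N (x + y) \<le> N x + N y" if "x \<in> V" "y \<in> V" for x y
    unfolding N_def
    by (rule triangle_of_convex_homogeneous[OF V_subspace r_pos G_nonneg G_scale G_convex that])
qed

lemma T_cut_le: "T a (cut A x) \<le> T a x"
  by (rule T_mono) (simp add: cut_def)

text \<open>
  Off the finitely many coordinates of the blocks in \<open>A\<close>, only the blocks outside \<open>A\<close> contribute,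
  and these form a tail of a convergent sum.
\<close>

lemma order_continuous:
  assumes x: "x \<in> V" and e: "0 < e"
  shows "\<exists>F. finite F \<and> N (cut (- F) x) \<le> e"
proof -
  have "0 < e powr r" using e by simp
  then obtain A where A: "finite A" "dist (\<Sum>a\<in>A. T a x) (G x) \<le> e powr r"
    using infsum_finite_approximation[OF V_summable[OF x]] unfolding G_def by metis
  define F where "F = (\<Union>a\<in>A. S a)"
  have sum: "(\<lambda>a. T a x) summable_on - A" "(\<lambda>a. T a x) summable_on A"
    using summable_on_subset_banach[OF V_summable[OF x]] by auto
  have "T a (cut (- F) x) = 0" if "a \<in> A" for a
    using that by (intro T_eq_0_off) (auto simp: cut_def F_def fun_eq_iff)
  then have "G (cut (- F) x) = (\<Sum>\<^sub>\<infinity>a\<in>- A. T a (cut (- F) x))"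
    unfolding G_def by (intro infsum_cong_neutral) auto
  also have "\<dots> \<le> (\<Sum>\<^sub>\<infinity>a\<in>- A. T a x)"
    by (intro infsum_mono T_cut_le summable_on_comparison_test[OF sum(1)] T_nonneg sum(1))
  also have "\<dots> = G x - (\<Sum>a\<in>A. T a x)"
    using infsum_Un_disjoint[OF sum(2,1)] A by (simp add: G_def)
  also have "\<dots> \<le> e powr r"
    using A(2) by (simp add: dist_real_def)
  finally have "N (cut (- F) x) \<le> e" using N_le_iff e by simp
  moreover have "finite F" using A(1) finite_S by (simp add: F_def)
  ultimately show ?thesis by blast
qed

lemma unit_mem: "unit_fun i \<in> V"
  using T_unit by (simp add: V_def)

text \<open>
  The blocks in a finite set \<open>A\<close> see only a finite cut-off of \<open>x\<close>, so each partial sum of the series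
  for \<open>x\<close> is bounded by the \<open>r\<close>-th power of the norm of such a cut-off.
\<close>

lemma Fatou:
  assumes "\<And>F. finite F \<Longrightarrow> N (cut F x) \<le> c"
  shows "x \<in> V"
proof -
  have c: "0 \<le> c" using assms[OF finite.emptyI] powr_ge_zero unfolding N_def by (rule order_trans[rotated])
  have "(\<Sum>a\<in>A. T a x) \<le> c powr r" if A: "finite A" for A
  proof -
    define F where "F = (\<Union>a\<in>A. S a)"
    have F: "finite F" using A finite_S by (simp add: F_def)
    have mem: "cut F x \<in> V"
      unfolding cut_eq_sum[OF F] by (intro subspace_sum subspace_scale V_subspace unit_mem)
    have "T a x \<le> T a (cut F x)" if "a \<in> A" for a
    proof -
      have "T a (cut (S a) x) \<le> T a (cut F x)"
        using that by (intro T_mono) (auto simp: cut_def F_def)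
      then show ?thesis by (simp add: T_local)
    qed
    then have "(\<Sum>a\<in>A. T a x) \<le> (\<Sum>a\<in>A. T a (cut F x))" by (rule sum_mono)
    also have "\<dots> \<le> G (cut F x)"
      unfolding G_def using A T_nonneg by (intro finite_sum_le_infsum V_summable mem) auto
    also have "\<dots> \<le> c powr r" using assms[OF F] N_le_iff c by simp
    finally show ?thesis .
  qed
  then show ?thesis
    unfolding V_def using T_nonneg
    by (auto intro!: nonneg_bdd_above_summable_on bdd_aboveI2)
qed

lemma disjoint_norm_le:
  assumes "x \<in> V" "y \<in> V" "\<And>i. x i = 0 \<or> y i = 0" "N x \<le> 1" "N y \<le> 1"
  shows "N (x + y) \<le> (2 * C) powr (1 / r)"
proof -
  have "G (x + y) \<le> (\<Sum>\<^sub>\<infinity>a. C * (T a x + T a y))"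
    using assms(1,2) T_disjoint[OF assms(3)]
    by (intro G_le summable_on_cmult_right summable_on_add V_summable)
  also have "\<dots> = C * (G x + G y)"
    using assms(1,2) by (simp add: G_def infsum_cmult_right' infsum_add V_summable)
  also have "\<dots> \<le> C * (1 + 1)"
    using assms(4,5) N_le_iff[of 1] C_bounds(1) by (intro mult_left_mono add_mono) auto
  finally show ?thesis
    using r_pos C_bounds(1) by (simp add: N_le_iff powr_powr)
qed

sublocale solid_function_space V N "(2 * C) powr (1 / r)"
proof
  show "cut A x \<in> V" if "x \<in> V" for A x
    using V_dominated[OF V_summable[OF that]] T_cut_le by blast
  show "N (cut A x) \<le> N x" if "x \<in> V" for A x
  proof -
    have "G (cut A x) \<le> G x"
      unfolding G_def[of x] by (rule G_le[OF V_summable[OF that] T_cut_le])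
    then show ?thesis
      unfolding N_def using r_pos G_nonneg by (intro powr_mono2) auto
  qed
  have "(2 * C) powr (1 / r) < (2 powr r) powr (1 / r)"
    using C_bounds r_pos by (intro powr_less_mono2) auto
  then show "(2 * C) powr (1 / r) < 2"
    using r_pos by (simp add: powr_powr)
  show "normed_space_on V N" by (rule V_normed)
  show "unit_fun i \<in> V" for i by (rule unit_mem)
  show "\<exists>F. finite F \<and> N (cut (- F) x) \<le> e" if "x \<in> V" "0 < e" for x e
    using that by (rule order_continuous)
  show "x \<in> V" if "\<And>F. finite F \<Longrightarrow> N (cut F x) \<le> c" for x c
    using that by (rule Fatou)
  show "N (x + y) \<le> (2 * C) powr (1 / r)"
    if "x \<in> V" "y \<in> V" "\<And>i. x i = 0 \<or> y i = 0" "N x \<le> 1" "N y \<le> 1" for x y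
    using that by (rule disjoint_norm_le)
qed

end

section \<open>Sums over dyadic blocks\<close>

text \<open>
  The norm is an iterated sum of extended nonnegative reals. The next three lemmas turn it into one
  real-valued sum over pairs, whose summability is equivalent to finiteness of the iterated sum.
\<close>

lemma infsum_ennreal_eq:
  fixes f :: "'a \<Rightarrow> real"
  assumes "f summable_on A" "\<And>x. x \<in> A \<Longrightarrow> 0 \<le> f x"
  shows "(\<Sum>\<^sub>\<infinity>x\<in>A. ennreal (f x)) = ennreal (\<Sum>\<^sub>\<infinity>x\<in>A. f x)"
proof -
  have "(\<Sum>\<^sub>\<infinity>x\<in>A. ennreal (f x)) = (SUP F\<in>{F. finite F \<and> F \<subseteq> A}. \<Sum>x\<in>F. ennreal (f x))"
    by (rule nonneg_infsum_complete) simp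
  also have "\<dots> = (SUP F\<in>{F. finite F \<and> F \<subseteq> A}. ennreal (sum f F))"
    using assms(2) by (intro SUP_cong refl sum_ennreal) auto
  also have "\<dots> = ennreal (\<Sum>\<^sub>\<infinity>x\<in>A. f x)"
    by (rule infsum_nonneg_is_SUPREMUM_ennreal[symmetric]) (use assms in auto)
  finally show ?thesis .
qed

lemma ennreal_iterated_sum_eq:
  fixes f :: "nat \<times> 'b \<Rightarrow> real"
  assumes nonneg: "\<And>a. 0 \<le> f a" and sum: "f summable_on UNIV"
  shows "(\<Sum>j. \<Sum>\<^sub>\<infinity>k. ennreal (f (j, k))) = ennreal (\<Sum>\<^sub>\<infinity>a. f a)"
proof -
  have sum': "f summable_on (SIGMA j:UNIV. UNIV)"
    using sum by simp
  have inner: "(\<lambda>k. f (j, k)) summable_on UNIV" for j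
    using summable_on_SigmaD1[of "\<lambda>j k. f (j, k)" UNIV "\<lambda>_. UNIV" j] sum' by (simp add: case_prod_unfold)
  define g where "g j = (\<Sum>\<^sub>\<infinity>k. f (j, k))" for j
  have g: "g summable_on UNIV" "0 \<le> g j" for j
    unfolding g_def using summable_on_SigmaD[OF sum' inner] nonneg
    by (auto intro: infsum_nonneg)
  have "(\<Sum>j. \<Sum>\<^sub>\<infinity>k. ennreal (f (j, k))) = (\<Sum>j. ennreal (g j))"
    unfolding g_def using infsum_ennreal_eq[OF inner] nonneg by simp
  also have "\<dots> = ennreal (\<Sum>\<^sub>\<infinity>j. g j)"
    using g by (intro suminf_ennreal_eq has_sum_imp_sums has_sum_infsum) auto
  also have "(\<Sum>\<^sub>\<infinity>j. g j) = (\<Sum>\<^sub>\<infinity>a. f a)"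
    unfolding g_def using infsum_Sigma_banach[OF sum'] by simp
  finally show ?thesis .
qed

lemma summable_of_ennreal_iterated_sum:
  fixes f :: "nat \<times> 'b \<Rightarrow> real"
  assumes nonneg: "\<And>a. 0 \<le> f a" and fin: "(\<Sum>j. \<Sum>\<^sub>\<infinity>k. ennreal (f (j, k))) < \<infinity>"
  shows "f summable_on UNIV"
proof (rule nonneg_bdd_above_summable_on)
  let ?s = "\<Sum>j. \<Sum>\<^sub>\<infinity>k. ennreal (f (j, k))"
  have "sum f A \<le> enn2real ?s" if A: "finite A" for A
  proof -
    have "ennreal (sum f A) = (\<Sum>a\<in>A. ennreal (f a))"
      using nonneg by simp
    also have "\<dots> \<le> (\<Sum>a\<in>fst ` A \<times> snd ` A. ennreal (f a))"
      using A by (intro sum_mono2) (auto simp: subset_fst_snd)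
    also have "\<dots> = (\<Sum>j\<in>fst ` A. \<Sum>k\<in>snd ` A. ennreal (f (j, k)))"
      by (simp add: sum.cartesian_product)
    also have "\<dots> \<le> (\<Sum>j\<in>fst ` A. \<Sum>\<^sub>\<infinity>k. ennreal (f (j, k)))"
    proof (rule sum_mono)
      fix j
      have "(\<Sum>\<^sub>\<infinity>k\<in>snd ` A. ennreal (f (j, k))) \<le> (\<Sum>\<^sub>\<infinity>k. ennreal (f (j, k)))"
        by (intro infsum_mono_neutral nonneg_summable_on_complete) auto
      then show "(\<Sum>k\<in>snd ` A. ennreal (f (j, k))) \<le> (\<Sum>\<^sub>\<infinity>k. ennreal (f (j, k)))"
        using A by simp
    qed
    also have "\<dots> \<le> ?s"
      using A by (intro sum_le_suminf) auto
    finally show ?thesis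
      using fin nonneg by (metis enn2real_ennreal enn2real_mono infinity_ennreal_def sum_nonneg)
  qed
  then show "bdd_above (sum f ` {F. F \<subseteq> UNIV \<and> finite F})"
    by (intro bdd_aboveI2) auto
qed (rule nonneg)

definition lpqr_term :: "real \<Rightarrow> real \<Rightarrow> real \<Rightarrow> nat \<times> int \<Rightarrow> (int \<Rightarrow> real) \<Rightarrow> real" where
  "lpqr_term p q r a x =
     (2 ^ fst a) powr (r * (1 / q - 1 / p)) *
     (\<Sum>l\<in>dyadic_interval (fst a) (snd a). \<bar>x l\<bar> powr p) powr (r / p)"

lemma lpqr_term_nonneg: "0 \<le> lpqr_term p q r a x"
  by (simp add: lpqr_term_def)

text \<open>Minkowski's inequality, as the case of the sum of the convex functions \<open>\<bar>z l\<bar> powr p\<close>.\<close>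

lemma powr_norm_triangle:
  fixes x y :: "'i \<Rightarrow> real"
  assumes p: "1 \<le> p"
  shows "(\<Sum>l\<in>I. \<bar>x l + y l\<bar> powr p) powr (1 / p)
      \<le> (\<Sum>l\<in>I. \<bar>x l\<bar> powr p) powr (1 / p) + (\<Sum>l\<in>I. \<bar>y l\<bar> powr p) powr (1 / p)"
proof -
  define G where "G z = (\<Sum>l\<in>I. \<bar>z l\<bar> powr p)" for z :: "'i \<Rightarrow> real"
  have "G (x + y) powr (1 / p) \<le> G x powr (1 / p) + G y powr (1 / p)"
  proof (rule triangle_of_convex_homogeneous[of UNIV p G x y])
    show "0 \<le> G z" for z by (simp add: G_def sum_nonneg)
    show "G (c *\<^sub>R z) = \<bar>c\<bar> powr p * G z" for c z
      by (simp add: G_def scaleR_fun_def abs_mult powr_mult sum_distrib_left)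
    fix t :: real and u v :: "'i \<Rightarrow> real" assume t: "0 \<le> t" "t \<le> 1"
    have "\<bar>(1 - t) * u l + t * v l\<bar> powr p \<le> (1 - t) * \<bar>u l\<bar> powr p + t * \<bar>v l\<bar> powr p" for l
    proof -
      have "\<bar>(1 - t) * u l + t * v l\<bar> \<le> (1 - t) * \<bar>u l\<bar> + t * \<bar>v l\<bar>"
        using t abs_triangle_ineq[of "(1 - t) * u l" "t * v l"] by (simp add: abs_mult)
      then have "\<bar>(1 - t) * u l + t * v l\<bar> powr p \<le> ((1 - t) * \<bar>u l\<bar> + t * \<bar>v l\<bar>) powr p"
        using p by (intro powr_mono2) auto
      also have "\<dots> \<le> (1 - t) * \<bar>u l\<bar> powr p + t * \<bar>v l\<bar> powr p"
        using p t by (intro powr_convex_nonneg) auto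
      finally show ?thesis .
    qed
    then show "G ((1 - t) *\<^sub>R u + t *\<^sub>R v) \<le> (1 - t) * G u + t * G v"
      by (simp add: G_def scaleR_fun_def sum_distrib_left sum.distrib[symmetric] sum_mono)
  qed (use p in auto)
  then show ?thesis by (simp add: G_def)
qed

text \<open>
  A summand is a multiple of \<open>f x powr r\<close> for the \<open>l\<^sup>p\<close>-seminorm \<open>f\<close> of the block, and a convex
  increasing function of a seminorm is convex.
\<close>

lemma lpqr_term_convex:
  assumes p: "1 < p" and r: "1 < r" and t: "0 \<le> t" "t \<le> 1"
  shows "lpqr_term p q r a ((1 - t) *\<^sub>R x + t *\<^sub>R y)
      \<le> (1 - t) * lpqr_term p q r a x + t * lpqr_term p q r a y"
proof -
  let ?I = "dyadic_interval (fst a) (snd a)"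
  define w :: real where "w = (2 ^ fst a) powr (r * (1 / q - 1 / p))"
  define f where "f x = (\<Sum>l\<in>?I. \<bar>x l\<bar> powr p) powr (1 / p)" for x :: "int \<Rightarrow> real"
  have T: "lpqr_term p q r a x = w * f x powr r" for x
    by (simp add: lpqr_term_def w_def f_def powr_powr)
  have f_scale: "f (c *\<^sub>R x) = \<bar>c\<bar> * f x" for c x
    using p by (simp add: f_def scaleR_fun_def abs_mult powr_mult sum_distrib_left[symmetric] powr_powr)
  have f_nonneg: "0 \<le> f x" for x by (simp add: f_def)
  have "f ((1 - t) *\<^sub>R x + t *\<^sub>R y) \<le> f ((1 - t) *\<^sub>R x) + f (t *\<^sub>R y)"
    unfolding f_def plus_fun_def using p by (intro powr_norm_triangle) simp
  then have "f ((1 - t) *\<^sub>R x + t *\<^sub>R y) \<le> (1 - t) * f x + t * f y"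
    using t by (simp add: f_scale)
  then have "f ((1 - t) *\<^sub>R x + t *\<^sub>R y) powr r \<le> ((1 - t) * f x + t * f y) powr r"
    using r f_nonneg by (intro powr_mono2) auto
  also have "\<dots> \<le> (1 - t) * f x powr r + t * f y powr r"
    using r t f_nonneg by (intro powr_convex_nonneg) auto
  finally have "w * f ((1 - t) *\<^sub>R x + t *\<^sub>R y) powr r \<le> w * ((1 - t) * f x powr r + t * f y powr r)"
    by (intro mult_left_mono) (auto simp: w_def)
  then show ?thesis unfolding T by (simp add: algebra_simps)
qed

lemma lpqr_term_disjoint:
  assumes p: "1 < p" and r: "1 < r" and disj: "\<And>i. x i = 0 \<or> y i = 0"
  shows "lpqr_term p q r a (x + y)
      \<le> max 1 (2 powr (r / p - 1)) * (lpqr_term p q r a x + lpqr_term p q r a y)"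
proof -
  let ?I = "dyadic_interval (fst a) (snd a)"
  define w :: real where "w = (2 ^ fst a) powr (r * (1 / q - 1 / p))"
  define G where "G x = (\<Sum>l\<in>?I. \<bar>x l\<bar> powr p)" for x :: "int \<Rightarrow> real"
  have T: "lpqr_term p q r a x = w * G x powr (r / p)" for x
    by (simp add: lpqr_term_def w_def G_def)
  have "\<bar>x l + y l\<bar> powr p = \<bar>x l\<bar> powr p + \<bar>y l\<bar> powr p" for l
    using disj[of l] by auto
  then have "G (x + y) = G x + G y"
    by (simp add: G_def sum.distrib)
  then have "G (x + y) powr (r / p) \<le> max 1 (2 powr (r / p - 1)) * (G x powr (r / p) + G y powr (r / p))"
    using powr_add_le[of "r / p" "G x" "G y"] p r by (simp add: G_def sum_nonneg)
  then have "w * G (x + y) powr (r / p)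
      \<le> w * (max 1 (2 powr (r / p - 1)) * (G x powr (r / p) + G y powr (r / p)))"
    by (intro mult_left_mono) (auto simp: w_def)
  then show ?thesis unfolding T by (simp add: algebra_simps)
qed

lemma mem_dyadic_interval_iff: "l \<in> dyadic_interval j k \<longleftrightarrow> k = l div 2 ^ j"
proof
  assume "l \<in> dyadic_interval j k"
  then have "l div 2 ^ j = k"
    by (intro int_div_pos_eq[of l "2 ^ j" k "l - 2 ^ j * k"])
      (auto simp: dyadic_interval_def algebra_simps)
  then show "k = l div 2 ^ j" by simp
next
  assume k: "k = l div 2 ^ j"
  have "l = 2 ^ j * k + l mod 2 ^ j" unfolding k by simp
  moreover have "0 \<le> l mod 2 ^ j" "l mod 2 ^ j < 2 ^ j" by simp_all
  ultimately show "l \<in> dyadic_interval j k"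
    unfolding dyadic_interval_def atLeastLessThan_iff distrib_left by linarith
qed

text \<open>
  At each scale \<open>j\<close> a coordinate lies in exactly one block, so the sum reduces to that of the
  weights, a geometric series with ratio below \<open>1\<close> because \<open>1 / q < 1 / p\<close>.
\<close>

lemma lpqr_term_unit_summable:
  assumes p: "1 < p" and pq: "p < q" and r: "1 < r"
  shows "(\<lambda>a. lpqr_term p q r a (unit_fun l)) summable_on UNIV"
proof -
  define \<rho> :: real where "\<rho> = 2 powr (r * (1 / q - 1 / p))"
  have "1 / q < 1 / p" using p pq by (simp add: field_simps)
  then have "r * (1 / q - 1 / p) < 0" using r by (simp add: mult_pos_neg)
  then have \<rho>: "0 \<le> \<rho>" "\<rho> < 1"
    using powr_less_mono[of "r * (1 / q - 1 / p)" 0 2] by (auto simp: \<rho>_def)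
  have w: "(2 ^ j) powr (r * (1 / q - 1 / p)) = \<rho> ^ j" for j
    by (simp add: \<rho>_def powr_realpow[symmetric] powr_powr mult.commute)
  have block: "(\<Sum>m\<in>dyadic_interval j k. \<bar>unit_fun l m\<bar> powr p) = (if k = l div 2 ^ j then 1 else 0)"
    for j k
  proof -
    have "(\<Sum>m\<in>dyadic_interval j k. \<bar>unit_fun l m\<bar> powr p)
        = (\<Sum>m\<in>dyadic_interval j k. if m = l then 1 else 0)"
      by (intro sum.cong) (auto simp: unit_fun_def)
    also have "\<dots> = (if l \<in> dyadic_interval j k then 1 else 0)"
      by (simp add: dyadic_interval_def)
    finally show ?thesis by (simp add: mem_dyadic_interval_iff)
  qed
  have "(\<lambda>a. lpqr_term p q r a (unit_fun l)) summable_on (SIGMA j:UNIV. UNIV)"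
  proof (rule summable_on_SigmaI)
    show "((\<lambda>k. lpqr_term p q r (j, k) (unit_fun l)) has_sum \<rho> ^ j) UNIV" for j
      by (rule has_sum_finite_neutralI[of "{l div 2 ^ j}"])
        (auto simp: lpqr_term_def block w split: if_splits)
    show "(\<lambda>j. \<rho> ^ j) summable_on UNIV"
      using \<rho> by (intro summable_nonneg_imp_summable_on summable_geometric) auto
  qed (rule lpqr_term_nonneg)
  then show ?thesis by simp
qed

text \<open>
  The blocks of scale \<open>0\<close> are single points, so that the summands determine \<open>x\<close>. The bound on the
  constant amounts to \<open>2 < 2 powr r\<close> and \<open>2 powr (r / p) < 2 powr r\<close>.
\<close>

lemma lpqr_local_convex_sum:
  assumes p: "1 < p" and pq: "p < q" and r: "1 < r"
  shows "local_convex_sum (lpqr_term p q r) (\<lambda>a. dyadic_interval (fst a) (snd a)) r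
           (max 1 (2 powr (r / p - 1)))"
proof
  show "finite (dyadic_interval (fst a) (snd a))" for a
    by (simp add: dyadic_interval_def)
  show "lpqr_term p q r a (cut (dyadic_interval (fst a) (snd a)) x) = lpqr_term p q r a x" for a x
    by (simp add: lpqr_term_def cut_def)
  show "lpqr_term p q r a x \<le> lpqr_term p q r a y" if "\<And>i. \<bar>x i\<bar> \<le> \<bar>y i\<bar>" for a x y
    unfolding lpqr_term_def using that p r
    by (intro mult_left_mono powr_mono2 sum_mono sum_nonneg) auto
  show "lpqr_term p q r a (c *\<^sub>R x) = \<bar>c\<bar> powr r * lpqr_term p q r a x" for a c x
    using p by (simp add: lpqr_term_def scaleR_fun_def abs_mult powr_mult
        sum_distrib_left[symmetric] powr_powr)
  show "x = 0" if "\<And>a. lpqr_term p q r a x = 0" for x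
  proof
    fix k
    have "dyadic_interval 0 k = {k}" by (auto simp: dyadic_interval_def)
    then show "x k = 0 k"
      using that[of "(0, k)"] p r by (simp add: lpqr_term_def powr_powr)
  qed
  have "r / p < r" using p r by (simp add: field_simps)
  moreover have "2 * 2 powr (r / p - 1) = 2 powr (r / p)"
    by (simp add: powr_diff)
  ultimately have "2 * 2 powr (r / p - 1) < 2 powr r" by simp
  moreover have "2 < (2::real) powr r" using powr_less_mono[of 1 r 2] r by simp
  ultimately show "2 * max 1 (2 powr (r / p - 1)) < 2 powr r" by (simp add: max_def)
qed (use p pq r in \<open>simp_all add: lpqr_term_nonneg lpqr_term_convex lpqr_term_disjoint
      lpqr_term_unit_summable\<close>)

lemma lpqr_enorm_eq:
  "lpqr_enorm p q r x =
     (if (\<lambda>a. lpqr_term p q r a x) summable_on UNIV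
      then ennreal ((\<Sum>\<^sub>\<infinity>a. lpqr_term p q r a x) powr (1 / r)) else \<infinity>)"
proof -
  let ?f = "\<lambda>a. lpqr_term p q r a x"
  let ?s = "\<Sum>j. \<Sum>\<^sub>\<infinity>k. ennreal (?f (j, k))"
  have enorm: "lpqr_enorm p q r x = ennreal_powr ?s (1 / r)"
    by (simp add: lpqr_enorm_def lpqr_term_def)
  show ?thesis
  proof (cases "?f summable_on UNIV")
    case True
    then have "?s = ennreal (\<Sum>\<^sub>\<infinity>a. ?f a)"
      by (intro ennreal_iterated_sum_eq lpqr_term_nonneg)
    then show ?thesis
      using True by (simp add: enorm ennreal_powr_def infsum_nonneg lpqr_term_nonneg)
  next
    case False
    then have "\<not> ?s < \<infinity>"
      using summable_of_ennreal_iterated_sum[of ?f] lpqr_term_nonneg by blast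
    then have "?s = \<infinity>" by (simp add: less_top[symmetric])
    then show ?thesis using False by (simp add: enorm ennreal_powr_def)
  qed
qed

text \<open>
  Both norms are \<open>0\<close> outside the space: an infinite extended real is converted to \<open>0\<close>, and so is a
  divergent sum. They therefore agree as functions.
\<close>

theorem proposition6p6:
  fixes p q r :: real
  assumes "1 < p" and "p < q" and "1 < r"
  shows "reflexive_space (lpqr_space p q r) (lpqr_norm p q r)"
proof -
  interpret local_convex_sum "lpqr_term p q r" "\<lambda>a. dyadic_interval (fst a) (snd a)" r
    "max 1 (2 powr (r / p - 1))"
    using assms by (rule lpqr_local_convex_sum)
  have "lpqr_space p q r = V"
    by (auto simp: lpqr_space_def V_def lpqr_enorm_eq)
  moreover have "lpqr_norm p q r = N"
    by (auto simp: fun_eq_iff lpqr_norm_def N_def G_def lpqr_enorm_eq infsum_not_exists)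
  ultimately show ?thesis using reflexive by simp
qed

end
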